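(* For every integer $n\ge 0$, \begin{align*} H_{3n}(F(x,6))&= H_{3n+1}(F(x,6))=(-1)^n(n+1)^2, \\ H_{3n+2}(F(x,6))&=(-1)^{n+1}\,\tfrac32 ( n+2 )( n+1 )( 2n+3 ). \end{align*}
   Context: For a power series $A(x)=\sum_{n\ge 0}a_nx^n$, the Hankel determinants are $H_n(A(x))=\det(a_{i+j})_{0\le i,j\le n-1}$ for $n\ge 1$, with $H_0(A(x))=1$. Let $C(x)=\sum_{n\ge0}C_nx^n$ with $C_n=\frac1{n+1}\binom{2n}{n}$ be the Catalan generating function (the unique power series with $C(x)=1+xC(x)^2$), and $F(x,r)=C(x)^r=\sum_{n\ge 0}\frac{r}{2n+r}\binom{2n+r}{n}x^n$ for positive integers $r$. *)

theory Defs
  imports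
    "HOL-Computational_Algebra.Formal_Power_Series"
    "Jordan_Normal_Form.Determinant"
begin

definition hankel_matrix :: "nat \<Rightarrow> 'a::comm_ring_1 fps \<Rightarrow> 'a mat" where
  "hankel_matrix n A = mat n n (\<lambda>(i, j). fps_nth A (i + j))"

definition hankel_det :: "nat \<Rightarrow> 'a::comm_ring_1 fps \<Rightarrow> 'a" where
  "hankel_det n A = det (hankel_matrix n A)"

lemma hankel_det_0 [simp]: "hankel_det 0 A = 1"
  by (simp add: hankel_det_def hankel_matrix_def)

definition catalan :: "nat \<Rightarrow> rat" where
  "catalan n = of_nat ((2 * n) choose n) / of_nat (n + 1)"

definition catalan_fps :: "rat fps" where
  "catalan_fps = Abs_fps catalan"

definition catalan_power :: "nat \<Rightarrow> rat fps" where
  "catalan_power r = catalan_fps ^ r"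

end

theory Submission
  imports Defs
begin

text \<open>
  Write \<open>C\<close> for the Catalan series and regard a power series \<open>A\<close> as the linear functional on polynomials
  that sends \<open>t ^ n\<close> to the \<open>n\<close>-th coefficient of \<open>A\<close> (\<open>moment A\<close>). If a monic polynomial \<open>p\<close> of
  degree \<open>n\<close> is orthogonal to all polynomials of lower degree, then
  \<open>H (n + 1) = moment A (t ^ n * p) * H n\<close>: replacing the last column of the Hankel matrix by its
  combination with the coefficients of \<open>p\<close> leaves only the corner entry of that column
  (\<open>hankel_det_Suc_orthogonal\<close>). So it suffices to know the orthogonal polynomials of \<open>C ^ 6\<close>.

  For \<open>C ^ 2\<close> they are classical: the Chebyshev polynomials of the second kind
  \<open>q k = U k ((t - 2) / 2)\<close>. More precisely, multiplying the argument by \<open>q k\<close> turns the functional of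
  \<open>C ^ 2\<close> into that of \<open>x ^ k * C ^ (2 * k + 2)\<close> (\<open>moment_shifted_chebyshev\<close>). The case \<open>k = 2\<close> shows
  that \<open>C ^ 6\<close> is \<open>C ^ 2\<close> multiplied by the polynomial weight
  \<open>w = t ^ 2 * q 2 = t ^ 2 * (t - 1) * (t - 3)\<close>.

  Orthogonal polynomials for a polynomial weight come from Christoffel's construction. If
  \<open>R = b0 * q n + b1 * q (n + 1) + b2 * q (n + 2) + b3 * q (n + 3) + q (n + 4)\<close> is divisible by \<open>w\<close>,
  then \<open>R / w\<close> is monic of degree \<open>n\<close>, is orthogonal for \<open>C ^ 6\<close> to everything of lower degree
  because \<open>R\<close> is so for \<open>C ^ 2\<close>, and its pairing with \<open>t ^ n\<close> is \<open>b0\<close>. Hence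
  \<open>H (n + 1) = b0 * H n\<close> (\<open>hankel_det_Suc_catalan_power_6\<close>). Divisibility by \<open>w\<close> amounts to four
  linear equations for \<open>b0, b1, b2, b3\<close>: \<open>R\<close> vanishes at \<open>1\<close>, at \<open>3\<close>, and doubly at \<open>0\<close>. The values
  of the \<open>q k\<close> at \<open>1\<close> and \<open>3\<close> are, up to sign, periodic in \<open>k\<close> with period 3, whereas at \<open>0\<close> the value
  and the derivative are polynomials in \<open>k\<close> up to sign. This is why the ratio \<open>b0\<close> is a rational
  function of \<open>n\<close> for each residue of \<open>n\<close> modulo 3, and multiplying the ratios gives the theorem.
\<close>

section \<open>The Catalan functional equation\<close>

lemma catalan_Suc: "of_nat (n + 2) * catalan (Suc n) = of_nat (4 * n + 2) * catalan n"
proof -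
  have 1: "Suc n * (Suc (2*n) choose Suc n) = Suc (2*n) * (2*n choose n)"
    using Suc_times_binomial[of n "2*n"] by simp
  have 2: "Suc (2*n) choose n = Suc (2*n) choose Suc n"
    by (subst binomial_symmetric) auto
  have 3: "(2 * Suc n choose Suc n) = 2 * (Suc (2*n) choose Suc n)"
    using 2 by simp
  have "Suc n * (2 * Suc n choose Suc n) = (4*n+2) * (2*n choose n)"
    using 1 3 by (simp add: algebra_simps)
  hence "(of_nat (Suc n * (2 * Suc n choose Suc n)) :: rat) = of_nat ((4*n+2) * (2*n choose n))"
    by (rule arg_cong)
  hence 4: "(of_nat n + 1) * (of_nat (2 * Suc n choose Suc n) :: rat) = (4 * of_nat n + 2) * of_nat (2*n choose n)"
    unfolding of_nat_mult by (simp add: algebra_simps)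
  have "(of_nat n + 1 :: rat) \<noteq> 0" "(of_nat n + 2 :: rat) \<noteq> 0"
    by (metis of_nat_Suc of_nat_eq_0_iff nat.distinct(1) add.commute)
       (metis of_nat_Suc of_nat_eq_0_iff nat.distinct(1) add.commute of_nat_add of_nat_numeral add_2_eq_Suc)
  with 4 show ?thesis
    unfolding catalan_def by (simp add: field_simps del: binomial_Suc_Suc mult_Suc_right)
qed

text \<open>
  Comparing coefficients turns the differential equation into a first-order recurrence. This serves
  to identify the square of \<open>1 - 2 * x * C\<close> without computing a convolution of binomials.
\<close>
lemma fps_ode_linear_unique:
  fixes f g :: "'a::field_char_0 fps"
  assumes f: "(1 - fps_const d * fps_X) * fps_deriv f = fps_const c * f"
    and g: "(1 - fps_const d * fps_X) * fps_deriv g = fps_const c * g"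
    and "fps_nth f 0 = fps_nth g 0"
  shows "f = g"
proof -
  have rec: "of_nat (Suc n) * fps_nth h (Suc n) = (c + d * of_nat n) * fps_nth h n"
    if "(1 - fps_const d * fps_X) * fps_deriv h = fps_const c * h" for h :: "'a fps" and n
  proof -
    have "fps_nth ((1 - fps_const d * fps_X) * fps_deriv h) n = c * fps_nth h n"
      by (simp add: that)
    thus ?thesis
      by (cases n) (simp_all add: left_diff_distrib mult.assoc algebra_simps)
  qed
  have "fps_nth f n = fps_nth g n" for n
  proof (induction n)
    case (Suc n)
    have "of_nat (Suc n) * fps_nth f (Suc n) = of_nat (Suc n) * fps_nth g (Suc n)"
      using rec[OF f, of n] rec[OF g, of n] Suc by simp
    thus ?case by (simp del: of_nat_Suc)
  qed (use assms in simp)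
  thus ?thesis by (simp add: fps_eq_iff)
qed

text \<open>
  By the quadratic formula the claim says that \<open>S = 1 - 2 * x * C\<close> is a square root of \<open>1 - 4 * x\<close>.
  The recurrence of the Catalan numbers is the differential equation \<open>(1 - 4 * x) * S' = - 2 * S\<close>;
  therefore \<open>S ^ 2\<close> satisfies \<open>(1 - 4 * x) * f' = - 4 * f\<close>, which \<open>1 - 4 * x\<close> solves as well.
\<close>
lemma catalan_fps_eq: "catalan_fps = 1 + fps_X * catalan_fps ^ 2"
proof -
  define S where "S = 1 - fps_const 2 * (fps_X * catalan_fps)"
  have S: "(1 - fps_const 4 * fps_X) * fps_deriv S = fps_const (-2) * S"
  proof (rule fps_ext)
    fix n
    show "fps_nth ((1 - fps_const 4 * fps_X) * fps_deriv S) n = fps_nth (fps_const (-2) * S) n"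
    proof (cases n)
      case (Suc m)
      thus ?thesis
        using catalan_Suc[of m]
        by (cases m) (simp_all add: left_diff_distrib mult.assoc S_def catalan_fps_def algebra_simps)
    qed (simp add: left_diff_distrib mult.assoc S_def catalan_fps_def catalan_def)
  qed
  have "S ^ 2 = 1 - fps_const 4 * fps_X"
  proof (rule fps_ode_linear_unique)
    have "(1 - fps_const 4 * fps_X) * fps_deriv (S ^ 2)
        = 2 * S * ((1 - fps_const 4 * fps_X) * fps_deriv S)"
      by (simp add: power2_eq_square algebra_simps)
    also have "\<dots> = (fps_const 2 * fps_const (-2)) * S ^ 2"
      unfolding S power2_eq_square numeral_fps_const by (simp only: mult_ac)
    also have "\<dots> = fps_const (-4) * S ^ 2"
      by simp
    finally show "(1 - fps_const 4 * fps_X) * fps_deriv (S ^ 2) = fps_const (-4) * S ^ 2" .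
  qed (simp_all add: S_def fps_nth_power_0 algebra_simps flip: fps_const_neg)
  hence "4 * fps_X * (catalan_fps - (1 + fps_X * catalan_fps ^ 2)) = 0"
    by (simp add: S_def power2_eq_square numeral_fps_const[symmetric] algebra_simps)
  thus ?thesis by simp
qed

section \<open>Moment functionals and Hankel determinants\<close>

text \<open>
  The linear functional on polynomials whose moments, the values at the powers of the variable,
  are the coefficients of \<open>a\<close>.
\<close>
definition moment :: "'a::comm_ring_1 fps \<Rightarrow> 'a poly \<Rightarrow> 'a" where
  "moment a p = (\<Sum>i\<le>degree p. coeff p i * fps_nth a i)"

lemma moment_eq_sum:
  assumes "degree p \<le> N"
  shows "moment a p = (\<Sum>i\<le>N. coeff p i * fps_nth a i)"
  unfolding moment_def
  by (rule sum.mono_neutral_left) (use assms in \<open>auto simp: coeff_eq_0\<close>)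

lemma moment_add_right: "moment a (p + q) = moment a p + moment a q"
proof -
  let ?N = "max (degree p) (degree q)"
  show ?thesis
    using moment_eq_sum[of "p+q" ?N a] moment_eq_sum[of p ?N a] moment_eq_sum[of q ?N a]
    by (simp add: degree_add_le sum.distrib algebra_simps)
qed

lemma moment_smult_right: "moment a (smult c p) = c * moment a p"
  using moment_eq_sum[of "smult c p" "degree p" a]
  by (simp add: moment_def sum_distrib_left mult.assoc degree_smult_le)

lemma moment_diff_right: "moment a (p - q) = moment a p - moment a q"
  using moment_add_right[of a p "smult (-1) q"] moment_smult_right[of a "-1" q] by simp

lemma moment_diff_left: "moment (a - b) p = moment a p - moment b p"
  by (simp add: moment_def sum_subtractf algebra_simps)

lemma moment_smult_left: "moment (fps_const c * a) p = c * moment a p"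
  by (simp add: moment_def sum_distrib_left algebra_simps)

lemma moment_pCons_0: "moment a (pCons 0 p) = moment (fps_shift 1 a) p"
proof -
  have "moment a (pCons 0 p) = (\<Sum>i\<le>Suc (degree p). coeff (pCons 0 p) i * fps_nth a i)"
    by (rule moment_eq_sum) (simp add: degree_pCons_le)
  thus ?thesis
    by (subst (asm) sum.atMost_Suc_shift) (simp add: moment_def)
qed

lemma moment_monom: "moment a (monom 1 n) = fps_nth a n"
  by (simp add: moment_eq_sum[OF degree_monom_le] if_distrib[of "\<lambda>x. x * _"] sum.delta cong: if_cong)

lemma moment_monom_mult: "moment a (monom 1 i * p) = moment (fps_shift i a) p"
proof (induction i arbitrary: a)
  case (Suc i)
  have "monom 1 (Suc i) * p = pCons 0 (monom 1 i * p)"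
    by (simp add: monom_Suc)
  moreover have "fps_shift i (fps_shift 1 a) = fps_shift (Suc i) a"
    by (rule fps_ext) simp
  ultimately show ?case using Suc[of "fps_shift 1 a"] by (simp add: moment_pCons_0)
qed (simp add: monom_0)

text \<open>
  Right multiplication of the Hankel matrix by the unitriangular matrix \<open>V\<close> whose last column
  holds the coefficients of \<open>p\<close> keeps the determinant and makes the last column the vector of all
  pairings of \<open>p\<close> with \<open>1, t, \<dots>, t ^ n\<close>. Orthogonality leaves only the last of them.
\<close>
lemma hankel_det_Suc_orthogonal:
  fixes a :: "'a::idom fps"
  assumes deg: "degree p = n" and monic: "lead_coeff p = 1"
    and orth: "\<And>i. i < n \<Longrightarrow> moment a (monom 1 i * p) = 0"
  shows "hankel_det (Suc n) a = moment a (monom 1 n * p) * hankel_det n a"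
proof -
  define V where "V = mat (Suc n) (Suc n) (\<lambda>(i,j). if j = n then coeff p i else if i = j then 1 else 0)"
  let ?H = "hankel_matrix (Suc n) a"
  have H: "?H \<in> carrier_mat (Suc n) (Suc n)" and V: "V \<in> carrier_mat (Suc n) (Suc n)"
    by (simp_all add: hankel_matrix_def V_def)
  have "det V = prod_list (diag_mat V)"
    by (rule det_upper_triangular[OF _ V]) (auto simp: V_def upper_triangular_def)
  also have "diag_mat V = replicate (Suc n) 1"
    by (rule nth_equalityI)
       (use deg monic in \<open>auto simp: diag_mat_def V_def simp del: replicate_Suc upt_Suc\<close>)
  finally have detV: "det V = 1" by simp
  define P where "P = ?H * V"
  have P: "P \<in> carrier_mat (Suc n) (Suc n)" using H V by (simp add: P_def)
  have Pij: "P $$ (i, j) = fps_nth a (i + j)" if "i < n" "j < n" for i j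
    using that by (simp add: P_def hankel_matrix_def V_def scalar_prod_def
        if_distrib[of "\<lambda>x. _ * x"] sum.delta cong: if_cong)
  have Pn: "P $$ (i, n) = moment a (monom 1 i * p)" if "i \<le> n" for i
  proof -
    have "P $$ (i, n) = (\<Sum>k<Suc n. fps_nth a (i + k) * coeff p k)"
      using that by (simp add: P_def hankel_matrix_def V_def scalar_prod_def atLeast0LessThan)
    thus ?thesis
      unfolding moment_monom_mult
      by (simp add: moment_def deg lessThan_Suc_atMost mult.commute add.commute)
  qed
  have "det ?H = det P" unfolding P_def using det_mult[OF H V] detV by simp
  also have "\<dots> = (\<Sum>i<Suc n. P $$ (i, n) * cofactor P i n)"
    by (rule laplace_expansion_column[OF P]) simp
  also have "\<dots> = P $$ (n, n) * cofactor P n n"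
    using Pn orth by simp
  also have "mat_delete P n n = hankel_matrix n a"
    by (rule eq_matI) (use P in \<open>auto simp: mat_delete_def hankel_matrix_def Pij\<close>)
  hence "cofactor P n n = hankel_det n a"
    by (simp add: cofactor_def hankel_det_def)
  finally show ?thesis using Pn[of n] by (simp add: hankel_det_def)
qed

section \<open>Shifted Chebyshev polynomials\<close>

text \<open>
  These are \<open>U n ((t - 2) / 2)\<close> for the Chebyshev polynomials \<open>U n\<close> of the second kind; the shift by 2
  centres the support \<open>[0, 4]\<close> of the measure whose moments are the Catalan numbers.
\<close>
fun shifted_chebyshev :: "nat \<Rightarrow> 'a::comm_ring_1 poly" where
  "shifted_chebyshev 0 = 1"
| "shifted_chebyshev (Suc 0) = [:-2, 1:]"
| "shifted_chebyshev (Suc (Suc n)) = [:-2, 1:] * shifted_chebyshev (Suc n) - shifted_chebyshev n"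

lemma degree_lead_coeff_shifted_chebyshev:
  "degree (shifted_chebyshev n :: 'a::idom poly) = n \<and> lead_coeff (shifted_chebyshev n :: 'a poly) = 1"
proof (induction n rule: shifted_chebyshev.induct)
  case (3 n)
  let ?q = "shifted_chebyshev :: nat \<Rightarrow> 'a poly"
  have ne: "?q (Suc n) \<noteq> 0" using 3 by auto
  have d: "degree ([:-2, 1:] * ?q (Suc n)) = Suc (Suc n)"
    using 3 ne by (subst degree_mult_eq) auto
  have l: "lead_coeff ([:-2, 1:] * ?q (Suc n)) = 1"
    unfolding lead_coeff_mult using conjunct2[OF 3(1)] by simp
  have lt: "degree (- ?q n) < degree ([:-2, 1:] * ?q (Suc n))" using 3 d by simp
  have "degree ([:-2, 1:] * ?q (Suc n) + - ?q n) = Suc (Suc n)"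
    using degree_add_eq_left[OF lt] d by simp
  moreover have "lead_coeff ([:-2, 1:] * ?q (Suc n) + - ?q n) = 1"
    using lead_coeff_add_le[OF lt] l lt by (simp add: lead_coeff_add_le add.commute)
  ultimately show ?case by simp
qed auto

lemma coeff_0_shifted_chebyshev:
  "coeff (shifted_chebyshev n :: 'a::comm_ring_1 poly) 0 = (-1) ^ n * (of_nat n + 1)"
proof (induction n rule: shifted_chebyshev.induct)
  case (3 n)
  have "coeff (shifted_chebyshev (Suc (Suc n)) :: 'a poly) 0
      = - 2 * coeff (shifted_chebyshev (Suc n)) 0 - coeff (shifted_chebyshev n) 0"
    by simp
  thus ?case unfolding 3 by (simp add: algebra_simps)
qed simp_all

lemma coeff_1_shifted_chebyshev:
  "coeff (shifted_chebyshev n :: 'a::field_char_0 poly) 1 = - ((-1) ^ n * (of_nat n * (of_nat n + 1) * (of_nat n + 2) / 6))"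
  by (induction n rule: shifted_chebyshev.induct)
     (auto simp: coeff_pCons coeff_0_shifted_chebyshev field_simps)

text \<open>
  At \<open>t = 1\<close> and \<open>t = 3\<close> the argument \<open>(t - 2) / 2\<close> is the cosine of \<open>2 * \<pi> / 3\<close> or \<open>\<pi> / 3\<close>, so
  the values repeat with period 3 up to sign. The hypothesis treats both points at once.
\<close>
lemma poly_shifted_chebyshev:
  fixes t :: "'a::comm_ring_1"
  assumes "(t - 2) ^ 2 = 1"
  shows "poly (shifted_chebyshev (3 * m)) t = (2 - t) ^ m"
    and "poly (shifted_chebyshev (3 * m + 1)) t = (t - 2) * (2 - t) ^ m"
    and "poly (shifted_chebyshev (3 * m + 2)) t = 0"
proof -
  let ?v = "\<lambda>k. poly (shifted_chebyshev k) t"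
  have rec: "?v (k + 2) = (t - 2) * ?v (k + 1) - ?v k" for k
    by (simp add: algebra_simps)
  have sq: "(t - 2) * ((t - 2) * c) = c" for c
    using assms by (simp add: power2_eq_square mult.assoc[symmetric])
  have "?v (3 * m) = (2 - t) ^ m \<and> ?v (3 * m + 1) = (t - 2) * (2 - t) ^ m"
  proof (induction m)
    case (Suc m)
    have idx: "3 * m + 1 + 1 = 3 * m + 2" "3 * m + 1 + 2 = 3 * m + 3"
      "3 * m + 2 + 1 = 3 * m + 3" "3 * m + 2 + 2 = 3 * Suc m + 1" "3 * m + 3 = 3 * Suc m"
      by simp_all
    have 2: "?v (3 * m + 2) = 0" using rec[of "3 * m"] Suc sq by simp
    have 3: "?v (3 * m + 3) = (2 - t) ^ Suc m"
      using rec[of "3 * m + 1"] Suc unfolding idx 2 by (simp add: algebra_simps)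
    have "?v (3 * Suc m + 1) = (t - 2) * (2 - t) ^ Suc m"
      using rec[of "3 * m + 2"] unfolding 2 idx(3,4) 3 by simp
    thus ?case using 3 unfolding idx by blast
  qed simp
  thus "?v (3 * m) = (2 - t) ^ m" "?v (3 * m + 1) = (t - 2) * (2 - t) ^ m" by blast+
  thus "?v (3 * m + 2) = 0" using rec[of "3 * m"] sq by simp
qed

text \<open>
  With \<open>y = x * C ^ 2\<close> the functional equation of \<open>C\<close> reads \<open>C ^ 2 = (1 + y) ^ 2\<close>, that is,
  \<open>y / x - 2 * y - 1 = y ^ 2\<close>. Multiplying the argument by \<open>t\<close> shifts the series, which is division
  by \<open>x\<close>; thus the three-term recurrence of the Chebyshev polynomials is matched by the sequence
  \<open>C ^ 2 * y ^ k\<close>. The factor \<open>f\<close> is general because the recurrence multiplies it by \<open>t - 2\<close>.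
\<close>
lemma moment_shifted_chebyshev:
  "moment (catalan_fps ^ 2) (shifted_chebyshev k * f)
     = moment (fps_X ^ k * catalan_fps ^ (2 * k + 2)) f"
proof -
  let ?B = "\<lambda>k. fps_X ^ k * catalan_fps ^ (2 * k + 2)"
  have two: "moment a ([:-2, 1:] * g) = moment (fps_shift 1 a - fps_const 2 * a) g" for a :: "rat fps" and g
  proof -
    have "[:-2, 1:] * g = pCons 0 g - smult 2 g" by simp
    thus ?thesis by (simp add: moment_diff_right moment_diff_left moment_smult_right moment_smult_left moment_pCons_0)
  qed
  have sq: "catalan_fps ^ 2 = 1 + fps_const 2 * fps_X * catalan_fps ^ 2 + fps_X ^ 2 * catalan_fps ^ 4"
    by (subst catalan_fps_eq) (simp add: power2_eq_square power4_eq_xxxx algebra_simps numeral_fps_const[symmetric])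
  \<comment> \<open>The first step needs its own argument: the shift drops the constant term 1 of \<open>C ^ 2\<close>,
    which is what subtracting the predecessor does in the later steps.\<close>
  have sh1: "fps_shift 1 (?B 0) - fps_const 2 * ?B 0 = ?B 1"
  proof (rule fps_ext)
    fix n
    show "fps_nth (fps_shift 1 (?B 0) - fps_const 2 * ?B 0) n = fps_nth (?B 1) n"
      using arg_cong[OF sq, of "\<lambda>s. fps_nth s (Suc n)"]
      by (simp add: mult.assoc power2_eq_square power4_eq_xxxx)
  qed
  have sh2: "fps_shift 1 (?B (Suc k)) - fps_const 2 * ?B (Suc k) - ?B k = ?B (Suc (Suc k))" for k
  proof -
    have 1: "fps_shift 1 (?B (Suc k)) = fps_X ^ k * catalan_fps ^ (2 * k + 2) * catalan_fps ^ 2"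
    proof -
      have "?B (Suc k) = fps_X * (fps_X ^ k * catalan_fps ^ (2 * k + 2) * catalan_fps ^ 2)"
        by (simp add: power2_eq_square mult_ac)
      thus ?thesis by (simp only: fps_eq_iff fps_shift_nth) simp
    qed
    show ?thesis unfolding 1
      by (subst sq) (simp add: algebra_simps power_add power2_eq_square power4_eq_xxxx)
  qed
  show ?thesis
  proof (induction k arbitrary: f rule: shifted_chebyshev.induct)
    case 1 show ?case by (simp add: power2_eq_square)
  next
    case 2
    have "?B 0 = catalan_fps ^ 2" by (simp add: power2_eq_square)
    hence "fps_shift 1 (catalan_fps ^ 2) - fps_const 2 * catalan_fps ^ 2 = ?B (Suc 0)"
      using sh1 by (simp only: One_nat_def)
    thus ?case using two[of "catalan_fps ^ 2" f] by (simp only: shifted_chebyshev.simps)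
  next
    case (3 k)
    have "shifted_chebyshev (Suc (Suc k)) * f
        = shifted_chebyshev (Suc k) * ([:-2, 1:] * f) - shifted_chebyshev k * f"
      by (simp add: algebra_simps)
    hence "moment (catalan_fps ^ 2) (shifted_chebyshev (Suc (Suc k)) * f)
        = moment (fps_shift 1 (?B (Suc k)) - fps_const 2 * ?B (Suc k) - ?B k) f"
      using 3 two by (simp only: moment_diff_right moment_diff_left)
    thus ?case by (simp only: sh2)
  qed
qed

lemma moment_shifted_chebyshev_monom:
  assumes "i \<le> k"
  shows "moment (catalan_fps ^ 2) (monom 1 i * shifted_chebyshev k) = (if i = k then 1 else 0)"
proof -
  have "fps_nth catalan_fps 0 = 1" by (simp add: catalan_fps_def catalan_def)
  thus ?thesis
    using assms moment_shifted_chebyshev[of k "monom 1 i"]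
    by (simp add: mult.commute[of "monom 1 i"] moment_monom fps_X_power_mult_nth fps_nth_power_0 del: power_Suc)
qed

section \<open>The weight relating the sixth power to the square\<close>

definition christoffel_weight :: "rat poly" where
  "christoffel_weight = monom 1 2 * shifted_chebyshev 2"

lemma christoffel_weight_eq: "christoffel_weight = [:-1, 1:] * ([:-3, 1:] * monom 1 2)"
  by (simp add: christoffel_weight_def numeral_2_eq_2 monom_Suc one_pCons)

text \<open>
  Multiplying by the second Chebyshev polynomial passes from \<open>C ^ 2\<close> to \<open>x ^ 2 * C ^ 6\<close>, and the
  factor \<open>t ^ 2\<close> shifts the \<open>x ^ 2\<close> away.
\<close>
lemma moment_catalan_power_6:
  "moment (catalan_power 6) f = moment (catalan_fps ^ 2) (christoffel_weight * f)"
proof -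
  have "moment (catalan_fps ^ 2) (christoffel_weight * f)
      = moment (catalan_fps ^ 2) (shifted_chebyshev 2 * (monom 1 2 * f))"
    by (simp add: christoffel_weight_def mult_ac)
  also have "\<dots> = moment (fps_shift 2 (fps_X ^ 2 * catalan_fps ^ 6)) f"
    by (simp only: moment_shifted_chebyshev moment_monom_mult) simp
  also have "fps_shift 2 (fps_X ^ 2 * catalan_fps ^ 6) = catalan_power 6"
    by (rule fps_ext) (simp add: catalan_power_def fps_X_power_mult_nth)
  finally show ?thesis by simp
qed

lemma christoffel_weight_dvdI:
  assumes "poly R 1 = 0" "poly R 3 = 0" "coeff R 0 = 0" "coeff R 1 = 0"
  shows "christoffel_weight dvd R"
proof -
  obtain A where A: "R = [:-1, 1:] * A" using assms(1) by (metis dvdE poly_eq_0_iff_dvd)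
  obtain B where B: "A = [:-3, 1:] * B" using assms(2) A by (auto simp: poly_eq_0_iff_dvd elim!: dvdE)
  have b0: "coeff B 0 = 0" using assms(3) A B by simp
  have "coeff B 1 = 0" using assms(4) A B b0 by (simp add: coeff_pCons)
  hence "monom 1 2 dvd B" using b0 by (auto simp: monom_1_dvd_iff' less_2_cases_iff)
  thus ?thesis unfolding christoffel_weight_eq A B by (intro mult_dvd_mono) auto
qed

text \<open>
  Christoffel's construction. The hypotheses say that the combination \<open>R\<close> of five consecutive
  Chebyshev polynomials vanishes at 1 and 3 and doubly at 0; the last two are its coefficients of
  degree 0 and 1, up to the factors \<open>(-1) ^ n\<close> and \<open>- (-1) ^ n / 6\<close>. The orthogonal polynomial is the
  quotient of \<open>R\<close> by the weight.
\<close>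
lemma hankel_det_Suc_catalan_power_6:
  fixes n :: nat and b0 b1 b2 b3 :: rat
  defines "q \<equiv> shifted_chebyshev :: nat \<Rightarrow> rat poly"
  assumes root: "\<And>t. t \<in> {1, 3} \<Longrightarrow> b0 * poly (q n) t + b1 * poly (q (n + 1)) t + b2 * poly (q (n + 2)) t
        + b3 * poly (q (n + 3)) t + poly (q (n + 4)) t = 0"
    and at_0: "b0 * (of_nat n + 1) - b1 * (of_nat n + 2) + b2 * (of_nat n + 3) - b3 * (of_nat n + 4)
        + (of_nat n + 5) = 0"
    and deriv_0: "b0 * of_nat n * (of_nat n + 1) * (of_nat n + 2)
        - b1 * (of_nat n + 1) * (of_nat n + 2) * (of_nat n + 3)
        + b2 * (of_nat n + 2) * (of_nat n + 3) * (of_nat n + 4)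
        - b3 * (of_nat n + 3) * (of_nat n + 4) * (of_nat n + 5)
        + (of_nat n + 4) * (of_nat n + 5) * (of_nat n + 6) = 0"
  shows "hankel_det (Suc n) (catalan_power 6) = b0 * hankel_det n (catalan_power 6)"
proof -
  have q: "degree (q k) = k" "lead_coeff (q k) = 1" for k
    using degree_lead_coeff_shifted_chebyshev[where 'a = rat, of k] by (auto simp: q_def)
  let ?R = "smult b0 (q n) + smult b1 (q (n + 1)) + smult b2 (q (n + 2)) + smult b3 (q (n + 3)) + q (n + 4)"
  have "christoffel_weight dvd ?R"
  proof (rule christoffel_weight_dvdI)
    have "coeff ?R 0 = (-1) ^ n * (b0 * (of_nat n + 1) - b1 * (of_nat n + 2) + b2 * (of_nat n + 3)
        - b3 * (of_nat n + 4) + (of_nat n + 5))"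
      by (simp add: q_def coeff_0_shifted_chebyshev power_add algebra_simps)
    thus "coeff ?R 0 = 0" using at_0 by simp
    have "coeff ?R 1 = - ((-1) ^ n / 6) * (b0 * of_nat n * (of_nat n + 1) * (of_nat n + 2)
        - b1 * (of_nat n + 1) * (of_nat n + 2) * (of_nat n + 3)
        + b2 * (of_nat n + 2) * (of_nat n + 3) * (of_nat n + 4)
        - b3 * (of_nat n + 3) * (of_nat n + 4) * (of_nat n + 5)
        + (of_nat n + 4) * (of_nat n + 5) * (of_nat n + 6))"
      unfolding q_def coeff_add coeff_smult coeff_1_shifted_chebyshev of_nat_add of_nat_numeral of_nat_1 power_add
      by (simp add: field_simps)
    thus "coeff ?R 1 = 0" using deriv_0 by simp
  qed (use root[of 1] root[of 3] in simp_all)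
  then obtain p where p: "?R = christoffel_weight * p" by (rule dvdE)
  have lt: "degree (smult b0 (q n) + smult b1 (q (n + 1)) + smult b2 (q (n + 2)) + smult b3 (q (n + 3)))
     < degree (q (n + 4))"
    by (intro degree_add_less le_less_trans[OF degree_smult_le]) (simp_all add: q)
  have dR: "degree ?R = n + 4" using degree_add_eq_right[OF lt] q by simp
  have lR: "lead_coeff ?R = 1" using lead_coeff_add_le[OF lt] q by simp
  have w: "degree christoffel_weight = 4" "lead_coeff christoffel_weight = 1"
    unfolding christoffel_weight_eq lead_coeff_mult
    by (simp_all add: degree_mult_eq lead_coeff_mult degree_monom_eq monom_eq_0_iff del: mult_pCons_left)
  have "?R \<noteq> 0" using dR by auto
  hence ne: "p \<noteq> 0" "christoffel_weight \<noteq> 0" using p by auto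
  have dp: "degree p = n" using dR ne w unfolding p by (simp add: degree_mult_eq)
  have lp: "lead_coeff p = 1" using lR w unfolding p by (simp add: lead_coeff_mult)
  have mom: "moment (catalan_power 6) (monom 1 i * p) = (if i = n then b0 else 0)" if "i \<le> n" for i
  proof -
    have "moment (catalan_power 6) (monom 1 i * p) = moment (catalan_fps ^ 2) (monom 1 i * ?R)"
      unfolding moment_catalan_power_6 p by (simp add: mult_ac)
    also have "\<dots> = (if i = n then b0 else 0)"
      using that
      by (simp add: distrib_left moment_add_right moment_smult_right q_def moment_shifted_chebyshev_monom
          del: shifted_chebyshev.simps)
    finally show ?thesis .
  qed
  show ?thesis
    using hankel_det_Suc_orthogonal[OF dp lp] mom by simp
qed

text \<open>
  In each residue class the coefficients \<open>b0, b1, b2, b3\<close> solve the four linear equations. The values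
  at 1 and at 3 of the \<open>k\<close>-th polynomial differ by \<open>(-1) ^ k\<close>, so vanishing at both points separates
  into one equation for \<open>b0, b2\<close> and one for \<open>b1, b3\<close>. They say \<open>b0 = 1\<close>, \<open>b1 = b3\<close> for \<open>n = 3 * m\<close>;
  \<open>b0 = b2\<close>, \<open>b3 = 0\<close> for \<open>n = 3 * m + 1\<close>; and \<open>b2 = 1\<close>, \<open>b1 = 0\<close> for \<open>n = 3 * m + 2\<close>. The two
  equations at 0 then determine the remaining two coefficients.
\<close>
lemma hankel_det_catalan_power_6_ratios:
  fixes m :: nat
  defines "H \<equiv> \<lambda>k. hankel_det k (catalan_power 6)" and "x \<equiv> (of_nat m :: rat)"
  shows "H (Suc (3 * m)) = H (3 * m)"
    and "H (Suc (3 * m + 1)) = - (3 * (x + 2) * (2 * x + 3) / (2 * (x + 1))) * H (3 * m + 1)"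
    and "H (Suc (3 * m + 2)) = 2 * (x + 2) / (3 * (x + 1) * (2 * x + 3)) * H (3 * m + 2)"
proof -
  have x: "x + 1 \<noteq> 0" "2 * x + 3 \<noteq> 0"
    using of_nat_0_le_iff[of m, where 'a = rat] by (auto simp: x_def)
  have v: "poly (shifted_chebyshev (3 * m)) t = e"
      "poly (shifted_chebyshev (3 * m + 1)) t = (t - 2) * e"
      "poly (shifted_chebyshev (3 * m + 2)) t = 0"
      "poly (shifted_chebyshev (3 * m + 3)) t = - ((t - 2) * e)"
      "poly (shifted_chebyshev (3 * m + 4)) t = - e"
      "poly (shifted_chebyshev (3 * m + 5)) t = 0"
      "poly (shifted_chebyshev (3 * m + 6)) t = e"
    if "t \<in> {1, 3}" "e = (2 - t) ^ m" for t e :: rat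
  proof -
    have "(t - 2) ^ 2 = 1" using that by auto
    note v = poly_shifted_chebyshev[OF this]
    show "poly (shifted_chebyshev (3 * m)) t = e"
      "poly (shifted_chebyshev (3 * m + 1)) t = (t - 2) * e"
      "poly (shifted_chebyshev (3 * m + 2)) t = 0"
      "poly (shifted_chebyshev (3 * m + 3)) t = - ((t - 2) * e)"
      "poly (shifted_chebyshev (3 * m + 4)) t = - e"
      "poly (shifted_chebyshev (3 * m + 5)) t = 0"
      "poly (shifted_chebyshev (3 * m + 6)) t = e"
      using that v[of m] v[of "m + 1"] v(1)[of "m + 2"]
      by (auto simp: algebra_simps simp del: shifted_chebyshev.simps)
  qed
  have "H (Suc (3 * m)) = 1 * H (3 * m)"
    unfolding H_def
  proof (rule hankel_det_Suc_catalan_power_6[where ?b1.0 = 4 and ?b2.0 = 6 and ?b3.0 = 4])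
    show "1 * poly (shifted_chebyshev (3 * m)) t + 4 * poly (shifted_chebyshev (3 * m + 1)) t
        + 6 * poly (shifted_chebyshev (3 * m + 2)) t + 4 * poly (shifted_chebyshev (3 * m + 3)) t
        + poly (shifted_chebyshev (3 * m + 4)) t = 0" if "t \<in> {1, 3}" for t :: rat
      unfolding v[OF that refl] by simp
  qed (simp_all add: algebra_simps)
  thus "H (Suc (3 * m)) = H (3 * m)" by simp
  show "H (Suc (3 * m + 1)) = - (3 * (x + 2) * (2 * x + 3) / (2 * (x + 1))) * H (3 * m + 1)"
    (is "_ = ?d * _")
    unfolding H_def
  proof (rule hankel_det_Suc_catalan_power_6[where ?b1.0 = "- (2 * (x + 2) * (3 * x + 4) / (x + 1))"
        and ?b2.0 = ?d and ?b3.0 = 0])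
    show "?d * poly (shifted_chebyshev (3 * m + 1)) t
        + - (2 * (x + 2) * (3 * x + 4) / (x + 1)) * poly (shifted_chebyshev (3 * m + 1 + 1)) t
        + ?d * poly (shifted_chebyshev (3 * m + 1 + 2)) t
        + 0 * poly (shifted_chebyshev (3 * m + 1 + 3)) t
        + poly (shifted_chebyshev (3 * m + 1 + 4)) t = 0" if "t \<in> {1, 3}" for t :: rat
    proof -
      have idx: "3 * m + 1 + 1 = 3 * m + 2" "3 * m + 1 + 2 = 3 * m + 3"
        "3 * m + 1 + 3 = 3 * m + 4" "3 * m + 1 + 4 = 3 * m + 5" by simp_all
      show ?thesis unfolding idx v[OF that refl] by simp
    qed
  qed (use x in \<open>simp_all add: divide_simps flip: x_def\<close>, (simp_all add: algebra_simps)?)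
  show "H (Suc (3 * m + 2)) = 2 * (x + 2) / (3 * (x + 1) * (2 * x + 3)) * H (3 * m + 2)"
    (is "_ = ?d * _")
    unfolding H_def
  proof (rule hankel_det_Suc_catalan_power_6[where ?b1.0 = 0 and ?b2.0 = 1
        and ?b3.0 = "4 * (3 * x + 5) / (3 * (2 * x + 3))"])
    show "?d * poly (shifted_chebyshev (3 * m + 2)) t
        + 0 * poly (shifted_chebyshev (3 * m + 2 + 1)) t
        + 1 * poly (shifted_chebyshev (3 * m + 2 + 2)) t
        + 4 * (3 * x + 5) / (3 * (2 * x + 3)) * poly (shifted_chebyshev (3 * m + 2 + 3)) t
        + poly (shifted_chebyshev (3 * m + 2 + 4)) t = 0" if "t \<in> {1, 3}" for t :: rat
    proof -
      have idx: "3 * m + 2 + 1 = 3 * m + 3" "3 * m + 2 + 2 = 3 * m + 4"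
        "3 * m + 2 + 3 = 3 * m + 5" "3 * m + 2 + 4 = 3 * m + 6" by simp_all
      show ?thesis unfolding idx v[OF that refl] by simp
    qed
  qed (use x in \<open>simp_all add: divide_simps flip: x_def\<close>, (simp_all add: algebra_simps)?)
qed

theorem theorem5:
  fixes n :: nat
  shows "hankel_det (3 * n) (catalan_power 6) = (-1) ^ n * (of_nat n + 1) ^ 2
    \<and> hankel_det (3 * n + 1) (catalan_power 6) = (-1) ^ n * (of_nat n + 1) ^ 2
    \<and> hankel_det (3 * n + 2) (catalan_power 6) =
           (-1) ^ (n + 1) * (3 / 2) * (of_nat n + 2) * (of_nat n + 1) * (2 * of_nat n + 3)"
proof -
  let ?H = "\<lambda>k. hankel_det k (catalan_power 6)"
  note ratios = hankel_det_catalan_power_6_ratios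
  have nz: "(of_nat m :: rat) + 1 \<noteq> 0" "2 * (of_nat m :: rat) + 3 \<noteq> 0" for m
    using of_nat_0_le_iff[of m, where 'a = rat] by auto
  have H1: "?H (3 * m + 1) = ?H (3 * m)" for m
    using ratios(1)[of m] by simp
  have H2: "?H (3 * m + 2) = (-1) ^ (m + 1) * (3 / 2) * (of_nat m + 2) * (of_nat m + 1) * (2 * of_nat m + 3)"
    if "?H (3 * m) = (-1) ^ m * (of_nat m + 1) ^ 2" for m
  proof -
    have "?H (3 * m + 2) = - (3 * (of_nat m + 2) * (2 * of_nat m + 3) / (2 * (of_nat m + 1))) * ?H (3 * m)"
      using ratios(2)[of m] H1[of m] by simp
    also have "\<dots> = (-1) ^ (m + 1) * (3 / 2) * (of_nat m + 2) * (of_nat m + 1) * (2 * of_nat m + 3)"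
      unfolding that using nz[of m] by (simp add: field_simps power2_eq_square)
    finally show ?thesis .
  qed
  have H0: "?H (3 * m) = (-1) ^ m * (of_nat m + 1) ^ 2" for m
  proof (induction m)
    case (Suc m)
    have "?H (3 * Suc m) = 2 * (of_nat m + 2) / (3 * (of_nat m + 1) * (2 * of_nat m + 3)) * ?H (3 * m + 2)"
      using ratios(3)[of m] by (simp add: numeral_eq_Suc)
    also have "\<dots> = (-1) ^ Suc m * (of_nat (Suc m) + 1) ^ 2"
      unfolding H2[OF Suc] using nz[of m]
      by (simp add: divide_simps) (simp add: algebra_simps power2_eq_square)
    finally show ?case .
  qed simp
  show ?thesis using H0 H1 H2 by simp
qed

end
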